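(* Let $G$ be a connected graph and let $e\in E(G)$ be an edge that is neither a loop nor a cut-edge. Then for every integer $k\ge 0$, $$\mathsf{els}_k(G)\ge \mathsf{els}_k(G/e)+\mathsf{els}_k(G\setminus e),$$ with equality for $k=0$.
   Context: Graphs are finite and undirected; loops and parallel edges are allowed. $G\setminus e$ is $G$ with the edge $e$ deleted (same vertex set). $G/e$ is obtained by removing $e$ and identifying its two endpoints into a single vertex, keeping all other edges (so edges parallel to $e$ become loops). A cut-edge is an edge $e$ such that $G\setminus e$ has more components than $G$. A nucleus of $G$ is a (nonempty) connected subgraph $N\subseteq G$ such that $V(N)$ is a vertex cover of $G$ (every edge of $G$, including loops, has at least one endpoint in $V(N)$); a single vertex with no edges is allowed as a connected subgraph. $\mathcal{N}(G)$ is the set of nuclei. For connected $G$ and integer $k\ge0$, the $k$-th Elser number is $$\mathsf{els}_k(G)=(-1)^{|V(G)|+1}\sum_{N\in\mathcal{N}(G)}(-1)^{|E(N)|}|V(N)|^k.$$ *)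

theory Defs
  imports Main
begin

record ('v, 'e) ugraph =
  verts :: "'v set"
  edges :: "'e set"
  ends :: "'e \<Rightarrow> 'v set"

text \<open>Edges have an identity of their own, so parallel edges are distinct edges with the same set
  of ends; an edge is a loop iff its set of ends is a singleton.\<close>

definition multigraph :: "('v, 'e) ugraph \<Rightarrow> bool" where
  "multigraph G \<longleftrightarrow> finite (verts G) \<and> finite (edges G) \<and>
     (\<forall>f\<in>edges G. \<exists>u\<in>verts G. \<exists>v\<in>verts G. ends G f = {u, v})"

definition is_loop :: "('v, 'e) ugraph \<Rightarrow> 'e \<Rightarrow> bool" where
  "is_loop G f \<longleftrightarrow> (\<exists>v. ends G f = {v})"

definition adjacency :: "('v, 'e) ugraph \<Rightarrow> ('v \<times> 'v) set" where
  "adjacency G = {(u, v). \<exists>f\<in>edges G. ends G f = {u, v}}"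

text \<open>The equivalence relation of being joined by a walk, restricted to the vertices because
  \<open>\<^sup>*\<close> is reflexive on the whole type.\<close>

definition reachability :: "('v, 'e) ugraph \<Rightarrow> ('v \<times> 'v) set" where
  "reachability G = (adjacency G)\<^sup>* \<inter> verts G \<times> verts G"

definition graph_components :: "('v, 'e) ugraph \<Rightarrow> 'v set set" where
  "graph_components G = verts G // reachability G"

definition graph_connected :: "('v, 'e) ugraph \<Rightarrow> bool" where
  "graph_connected G \<longleftrightarrow> verts G \<noteq> {} \<and>
     (\<forall>u\<in>verts G. \<forall>v\<in>verts G. (u, v) \<in> reachability G)"

definition delete_edge :: "('v, 'e) ugraph \<Rightarrow> 'e \<Rightarrow> ('v, 'e) ugraph" where
  "delete_edge G e = G\<lparr>edges := edges G - {e}\<rparr>"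

definition is_cut_edge :: "('v, 'e) ugraph \<Rightarrow> 'e \<Rightarrow> bool" where
  "is_cut_edge G e \<longleftrightarrow> e \<in> edges G \<and>
     card (graph_components (delete_edge G e)) > card (graph_components G)"

text \<open>The vertices of \<open>G/e\<close> are the blocks of the partition of \<open>V(G)\<close> that merges exactly the ends
  of \<open>e\<close>: the block \<open>ends G e\<close>, and a singleton for every other vertex.\<close>

definition contract_vertex :: "('v, 'e) ugraph \<Rightarrow> 'e \<Rightarrow> 'v \<Rightarrow> 'v set" where
  "contract_vertex G e v = (if v \<in> ends G e then ends G e else {v})"

definition contract_edge :: "('v, 'e) ugraph \<Rightarrow> 'e \<Rightarrow> ('v set, 'e) ugraph" where
  "contract_edge G e =
     \<lparr>verts = contract_vertex G e ` verts G,
      edges = edges G - {e},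
      ends = (\<lambda>f. contract_vertex G e ` ends G f)\<rparr>"

text \<open>A subgraph keeps the whole function \<open>ends\<close>, also off its own edges, so that it is
  determined by its vertices and edges and is counted once in sums over subgraphs.\<close>

definition subgraph_of :: "('v, 'e) ugraph \<Rightarrow> ('v, 'e) ugraph \<Rightarrow> bool" where
  "subgraph_of H G \<longleftrightarrow> multigraph H \<and> verts H \<subseteq> verts G \<and> edges H \<subseteq> edges G \<and> ends H = ends G"

definition vertex_cover :: "('v, 'e) ugraph \<Rightarrow> 'v set \<Rightarrow> bool" where
  "vertex_cover G W \<longleftrightarrow> W \<subseteq> verts G \<and> (\<forall>f\<in>edges G. ends G f \<inter> W \<noteq> {})"

definition nuclei :: "('v, 'e) ugraph \<Rightarrow> ('v, 'e) ugraph set" where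
  "nuclei G = {N. subgraph_of N G \<and> graph_connected N \<and> vertex_cover G (verts N)}"

definition els :: "nat \<Rightarrow> ('v, 'e) ugraph \<Rightarrow> int" where
  "els k G = (-1) ^ (card (verts G) + 1) *
     (\<Sum>N\<in>nuclei G. (-1) ^ card (edges N) * int (card (verts N)) ^ k)"

lemma finite_nuclei:
  assumes "multigraph G"
  shows "finite (nuclei G)"
proof -
  have "nuclei G \<subseteq> (\<lambda>(W, F). \<lparr>verts = W, edges = F, ends = ends G\<rparr>) ` (Pow (verts G) \<times> Pow (edges G))"
  proof
    fix N assume "N \<in> nuclei G"
    then have "N = \<lparr>verts = verts N, edges = edges N, ends = ends G\<rparr>"
      and "verts N \<subseteq> verts G" and "edges N \<subseteq> edges G"
      by (simp_all add: nuclei_def subgraph_of_def)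
    then show "N \<in> (\<lambda>(W, F). \<lparr>verts = W, edges = F, ends = ends G\<rparr>) ` (Pow (verts G) \<times> Pow (edges G))"
      by (intro image_eqI[where x = "(verts N, edges N)"]) auto
  qed
  then show ?thesis
    using assms by (auto simp: multigraph_def intro: finite_subset)
qed

lemma multigraph_delete_edge:
  "multigraph G \<Longrightarrow> multigraph (delete_edge G e)"
  by (simp add: multigraph_def delete_edge_def)

lemma multigraph_contract_edge:
  assumes "multigraph G"
  shows "multigraph (contract_edge G e)"
  unfolding multigraph_def
proof (intro conjI ballI)
  fix f assume "f \<in> edges (contract_edge G e)"
  then obtain u v where "u \<in> verts G" "v \<in> verts G" "ends G f = {u, v}"
    using assms by (auto simp: multigraph_def contract_edge_def)
  then show "\<exists>u\<in>verts (contract_edge G e). \<exists>v\<in>verts (contract_edge G e).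
      ends (contract_edge G e) f = {u, v}"
    by (auto simp: contract_edge_def)
qed (use assms in \<open>simp_all add: multigraph_def contract_edge_def\<close>)

end

theory Submission
  imports Defs
begin

text \<open>
  Let \<open>e\<close> join \<open>x\<close> and \<open>y\<close>. The nuclei of \<open>G\<close> that contain \<open>e\<close> correspond to the nuclei of \<open>G/e\<close>
  through the merged vertex. The nuclei of \<open>G\<close> without \<open>e\<close> are the nuclei of \<open>G - e\<close> that meet
  \<open>{x, y}\<close>, and the nuclei of \<open>G - e\<close> that avoid both \<open>x\<close> and \<open>y\<close> correspond to the nuclei of \<open>G/e\<close>
  that avoid the merged vertex. So for every weight on vertex sets the signed sum over nuclei
  satisfies a deletion-contraction identity, provided a nucleus of \<open>G/e\<close> gets the weight of the
  preimage of its vertex set (\<open>weighted_els_deletion_contraction\<close>).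

  For the weight \<open>|W|\<^sup>k\<close> this falls short of an identity between Elser numbers only because the
  preimage of a set through the merged vertex has one vertex more than the set. The excess
  \<open>(n + 1)\<^sup>k - n\<^sup>k\<close> counts the words of length \<open>k\<close> over the preimage in which the letter \<open>y\<close>
  occurs. Summing word by word, the difference of the two sides of the theorem becomes a sum, over
  words \<open>xs\<close> containing \<open>y\<close>, of signed counts of the nuclei of \<open>G/e\<close> through the image of the
  letters of \<open>xs\<close> (\<open>els_deletion_contraction\<close>). There is no such word for \<open>k = 0\<close>, which gives
  equality.

  What remains is that in a connected graph the signed count of the nuclei through a nonempty set
  \<open>U\<close> is nonnegative (\<open>els_through_nonneg\<close>). This follows by induction from the same
  deletion-contraction identity. The count vanishes if the graph has a loop or a pendant vertex
  outside \<open>U\<close>, since adding or removing the loop or the pendant vertex pairs nuclei of opposite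
  sign. A single vertex without edges is its own only nucleus. In all other cases, if \<open>G - e\<close> is
  disconnected then it has no nucleus through \<open>U\<close> at all, so only connected graphs contribute.
\<close>

section \<open>Connectedness by closed vertex sets\<close>

definition edge_closed :: "('v, 'e) ugraph \<Rightarrow> 'v set \<Rightarrow> bool" where
  "edge_closed G S \<longleftrightarrow> (\<forall>f\<in>edges G. ends G f \<inter> S \<noteq> {} \<longrightarrow> ends G f \<subseteq> S)"

lemma edge_closedD:
  "edge_closed G S \<Longrightarrow> f \<in> edges G \<Longrightarrow> u \<in> ends G f \<Longrightarrow> u \<in> S \<Longrightarrow> w \<in> ends G f \<Longrightarrow> w \<in> S"
  unfolding edge_closed_def by blast

lemma ends_subset_verts: "multigraph G \<Longrightarrow> f \<in> edges G \<Longrightarrow> ends G f \<subseteq> verts G"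
  unfolding multigraph_def by fastforce

lemma ends_nonempty: "multigraph G \<Longrightarrow> f \<in> edges G \<Longrightarrow> ends G f \<noteq> {}"
  unfolding multigraph_def by fastforce

text \<open>Closed sets pull back and push forward along a contraction, and survive the removal of a loop or
  a pendant vertex, more directly than walks do. All connectedness arguments below therefore use
  this cut form.\<close>

lemma graph_connected_iff_no_proper_closed_set:
  assumes "multigraph G"
  shows "graph_connected G \<longleftrightarrow>
    verts G \<noteq> {} \<and> (\<forall>S\<subseteq>verts G. S \<noteq> {} \<longrightarrow> edge_closed G S \<longrightarrow> verts G \<subseteq> S)"
    (is "_ \<longleftrightarrow> _ \<and> ?no_cut")
proof
  assume conn: "graph_connected G"
  have "verts G \<subseteq> S" if S: "S \<subseteq> verts G" "S \<noteq> {}" "edge_closed G S" for S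
  proof
    fix v assume v: "v \<in> verts G"
    obtain u where u: "u \<in> S" using S by blast
    then have "(u, v) \<in> (adjacency G)\<^sup>*"
      using conn v S by (auto simp: graph_connected_def reachability_def)
    then show "v \<in> S"
    proof (induction rule: rtrancl_induct)
      case (step a b)
      then obtain f where "f \<in> edges G" "ends G f = {a, b}"
        by (auto simp: adjacency_def)
      with step S(3) show ?case by (auto simp: edge_closed_def)
    qed (use u in simp)
  qed
  with conn show "verts G \<noteq> {} \<and> ?no_cut" by (auto simp: graph_connected_def)
next
  assume R: "verts G \<noteq> {} \<and> ?no_cut"
  have "(u, v) \<in> reachability G" if uv: "u \<in> verts G" "v \<in> verts G" for u v
  proof -
    define S where "S = {w \<in> verts G. (u, w) \<in> (adjacency G)\<^sup>*}"
    have "edge_closed G S"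
      unfolding edge_closed_def
    proof (intro ballI impI)
      fix f assume f: "f \<in> edges G" and meet: "ends G f \<inter> S \<noteq> {}"
      obtain a b where ab: "a \<in> verts G" "b \<in> verts G" "ends G f = {a, b}"
        using assms f by (auto simp: multigraph_def)
      have "(a, b) \<in> adjacency G" "(b, a) \<in> adjacency G"
        using f ab by (auto simp: adjacency_def insert_commute)
      with meet ab show "ends G f \<subseteq> S"
        by (auto simp: S_def intro: rtrancl_into_rtrancl)
    qed
    moreover have "u \<in> S" "S \<subseteq> verts G" using uv by (auto simp: S_def)
    ultimately have "v \<in> S" using R uv by blast
    then show ?thesis using uv by (simp add: S_def reachability_def)
  qed
  with R show "graph_connected G" by (auto simp: graph_connected_def)
qed

lemma mem_nuclei_iff:
  assumes "multigraph G"
  shows "N \<in> nuclei G \<longleftrightarrow>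
    ends N = ends G \<and> verts N \<subseteq> verts G \<and> edges N \<subseteq> edges G \<and>
    (\<forall>f\<in>edges N. ends G f \<subseteq> verts N) \<and> verts N \<noteq> {} \<and>
    (\<forall>S\<subseteq>verts N. S \<noteq> {} \<longrightarrow> edge_closed N S \<longrightarrow> verts N \<subseteq> S) \<and>
    (\<forall>f\<in>edges G. ends G f \<inter> verts N \<noteq> {})"
proof -
  have "multigraph N \<longleftrightarrow> (\<forall>f\<in>edges N. ends G f \<subseteq> verts N)"
    if "ends N = ends G" "verts N \<subseteq> verts G" "edges N \<subseteq> edges G"
  proof
    assume "multigraph N"
    then show "\<forall>f\<in>edges N. ends G f \<subseteq> verts N"
      using ends_subset_verts[of N] that by simp
  next
    assume R: "\<forall>f\<in>edges N. ends G f \<subseteq> verts N"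
    show "multigraph N"
      unfolding multigraph_def
    proof (intro conjI ballI)
      fix f assume f: "f \<in> edges N"
      then have "f \<in> edges G" using that by blast
      then obtain u v where uv: "ends G f = {u, v}"
        using assms unfolding multigraph_def by blast
      then have "u \<in> verts N" "v \<in> verts N" using R f by auto
      then show "\<exists>u\<in>verts N. \<exists>v\<in>verts N. ends N f = {u, v}"
        using uv that(1) by auto
    next
      show "finite (verts N)" "finite (edges N)"
        using assms that finite_subset unfolding multigraph_def by blast+
    qed
  qed
  then show ?thesis
    using graph_connected_iff_no_proper_closed_set[of N]
    unfolding nuclei_def subgraph_of_def vertex_cover_def by auto
qed

lemma finite_edges_nucleus:
  "N \<in> nuclei G \<Longrightarrow> finite (edges N)"
  by (simp add: nuclei_def subgraph_of_def multigraph_def)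

lemma verts_nucleus_subset: "N \<in> nuclei G \<Longrightarrow> verts N \<subseteq> verts G"
  by (simp add: nuclei_def subgraph_of_def)


section \<open>Deletion and contraction for weighted nucleus sums\<close>

text \<open>The weight stays arbitrary because the powers of \<open>|W|\<close> and the indicator functions
  of \<open>U \<subseteq> W\<close> must both go through deletion and contraction.\<close>

definition weighted_els :: "('v set \<Rightarrow> int) \<Rightarrow> ('v, 'e) ugraph \<Rightarrow> int" where
  "weighted_els g G =
     (-1) ^ (card (verts G) + 1) * (\<Sum>N\<in>nuclei G. (-1) ^ card (edges N) * g (verts N))"

lemma els_eq_weighted_els: "els k G = weighted_els (\<lambda>W. int (card W) ^ k) G"
  by (simp add: els_def weighted_els_def)

lemma weighted_els_cong:
  assumes "\<And>W. W \<subseteq> verts G \<Longrightarrow> g W = h W"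
  shows "weighted_els g G = weighted_els h G"
proof -
  have "(\<Sum>N\<in>nuclei G. (-1) ^ card (edges N) * g (verts N)) =
      (\<Sum>N\<in>nuclei G. (-1) ^ card (edges N) * h (verts N))"
    by (rule sum.cong) (simp_all add: assms verts_nucleus_subset)
  then show ?thesis by (simp add: weighted_els_def)
qed

lemma weighted_els_add:
  "weighted_els (\<lambda>W. g W + h W) G = weighted_els g G + weighted_els h G"
  by (simp add: weighted_els_def distrib_left sum.distrib)

lemma weighted_els_sum:
  "weighted_els (\<lambda>W. \<Sum>i\<in>I. g i W) G = (\<Sum>i\<in>I. weighted_els (g i) G)"
  unfolding weighted_els_def by (simp add: sum_distrib_left, rule sum.swap)

text \<open>With \<open>\<pi> = contract_vertex G e\<close> this is \<open>contract_edge G e\<close>. Allowing any \<open>\<pi>\<close> makes it possible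
  to contract within the vertex type of \<open>G\<close>, by sending \<open>y\<close> to \<open>x\<close>; an induction that contracts
  repeatedly needs this, as the type may not change along it.\<close>

definition quotient_graph :: "('v \<Rightarrow> 'w) \<Rightarrow> 'e \<Rightarrow> ('v, 'e) ugraph \<Rightarrow> ('w, 'e) ugraph" where
  "quotient_graph \<pi> e G =
     \<lparr>verts = \<pi> ` verts G, edges = edges G - {e}, ends = (\<lambda>f. \<pi> ` ends G f)\<rparr>"

lemma quotient_graph_simps [simp]:
  "verts (quotient_graph \<pi> e G) = \<pi> ` verts G"
  "edges (quotient_graph \<pi> e G) = edges G - {e}"
  "ends (quotient_graph \<pi> e G) f = \<pi> ` ends G f"
  by (simp_all add: quotient_graph_def)

lemma delete_edge_simps [simp]:
  "verts (delete_edge G e) = verts G"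
  "edges (delete_edge G e) = edges G - {e}"
  "ends (delete_edge G e) = ends G"
  by (simp_all add: delete_edge_def)

lemma multigraph_quotient_graph:
  assumes "multigraph G"
  shows "multigraph (quotient_graph \<pi> e G)"
  unfolding multigraph_def
proof (intro conjI ballI)
  fix f assume "f \<in> edges (quotient_graph \<pi> e G)"
  then obtain u v where "u \<in> verts G" "v \<in> verts G" "ends G f = {u, v}"
    using assms by (auto simp: multigraph_def)
  then show "\<exists>u\<in>verts (quotient_graph \<pi> e G). \<exists>v\<in>verts (quotient_graph \<pi> e G).
      ends (quotient_graph \<pi> e G) f = {u, v}"
    by auto
qed (use assms in \<open>simp_all add: multigraph_def\<close>)

locale contraction_map =
  fixes G :: "('v, 'e) ugraph" and e :: 'e and x y :: 'v and \<pi> :: "'v \<Rightarrow> 'w"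
  assumes multigraph: "multigraph G"
    and e_in: "e \<in> edges G"
    and ends_e: "ends G e = {x, y}"
    and x_neq_y: "x \<noteq> y"
    and pi_eq_iff:
      "u \<in> verts G \<Longrightarrow> v \<in> verts G \<Longrightarrow>
        \<pi> u = \<pi> v \<longleftrightarrow> u = v \<or> (u \<in> {x, y} \<and> v \<in> {x, y})"
begin

abbreviation Q :: "('w, 'e) ugraph" where "Q \<equiv> quotient_graph \<pi> e G"

lemma xy_in: "x \<in> verts G" "y \<in> verts G"
  using ends_subset_verts[OF multigraph e_in] ends_e by auto

lemma pi_xy: "\<pi> x = \<pi> y"
  using pi_eq_iff xy_in by blast

text \<open>Apart from \<open>y\<close>, which duplicates \<open>x\<close>, the map \<open>\<pi>\<close> is a bijection.\<close>

lemma card_vimage_minus_y: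
  assumes W: "W \<subseteq> verts Q"
  shows "card (verts G \<inter> \<pi> -` W - {y}) = card W"
proof (rule bij_betw_same_card[of \<pi>])
  have "W \<subseteq> \<pi> ` (verts G \<inter> \<pi> -` W - {y})"
  proof
    fix w assume w: "w \<in> W"
    then obtain v where "v \<in> verts G" "w = \<pi> v" using W by auto
    then show "w \<in> \<pi> ` (verts G \<inter> \<pi> -` W - {y})"
      using w xy_in x_neq_y pi_xy
      by (cases "v = y") (auto intro: image_eqI[where x = x] image_eqI[where x = v])
  qed
  then show "bij_betw \<pi> (verts G \<inter> \<pi> -` W - {y}) W"
    using pi_eq_iff by (auto simp: bij_betw_def inj_on_def)
qed

lemma card_verts_quotient: "card (verts G) = card (verts Q) + 1"
proof -
  have "verts G \<inter> \<pi> -` verts Q = verts G" by auto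
  then have "card (verts G - {y}) = card (verts Q)"
    using card_vimage_minus_y[of "verts Q"] by simp
  moreover have "finite (verts G)" using multigraph by (simp add: multigraph_def)
  ultimately show ?thesis
    using card_Suc_Diff1[of "verts G" y] xy_in(2) by (metis Suc_eq_plus1)
qed

definition lift :: "('w, 'e) ugraph \<Rightarrow> ('v, 'e) ugraph" where
  "lift N' = \<lparr>verts = verts G \<inter> \<pi> -` verts N',
     edges = (if \<pi> x \<in> verts N' then {e} else {}) \<union> edges N', ends = ends G\<rparr>"

lemma lift_simps [simp]:
  "verts (lift N') = verts G \<inter> \<pi> -` verts N'"
  "edges (lift N') = (if \<pi> x \<in> verts N' then {e} else {}) \<union> edges N'"
  "ends (lift N') = ends G"
  by (simp_all add: lift_def)

text \<open>The nuclei with \<open>e\<close> lift those of \<open>G/e\<close> through the merged vertex, and the nuclei of \<open>G - e\<close>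
  avoiding \<open>x\<close> and \<open>y\<close> lift the others. Taking both kinds together gives a single bijection with
  the nuclei of \<open>G/e\<close>.\<close>

definition liftable_nuclei :: "('v, 'e) ugraph set" where
  "liftable_nuclei = {N \<in> nuclei G. e \<in> edges N} \<union>
     {N \<in> nuclei (delete_edge G e). x \<notin> verts N \<and> y \<notin> verts N}"

lemmas mem_nuclei_G = mem_nuclei_iff[OF multigraph]
lemmas mem_nuclei_delete = mem_nuclei_iff[OF multigraph_delete_edge[OF multigraph, of e]]
lemmas mem_nuclei_Q = mem_nuclei_iff[OF multigraph_quotient_graph[OF multigraph, of \<pi> e]]

text \<open>Both kinds of liftable nuclei contain \<open>x\<close> iff they contain \<open>y\<close> iff they contain \<open>e\<close>. With that
  and the cover condition for the edges other than \<open>e\<close>, the two kinds need not be told apart.\<close>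

lemma liftable_nucleiD:
  assumes "N \<in> liftable_nuclei"
  shows "ends N = ends G" "verts N \<subseteq> verts G" "edges N \<subseteq> edges G"
    "\<And>f. f \<in> edges N \<Longrightarrow> ends G f \<subseteq> verts N" "verts N \<noteq> {}"
    "\<And>S. S \<subseteq> verts N \<Longrightarrow> S \<noteq> {} \<Longrightarrow> edge_closed N S \<Longrightarrow> verts N \<subseteq> S"
    "\<And>f. f \<in> edges G \<Longrightarrow> f \<noteq> e \<Longrightarrow> ends G f \<inter> verts N \<noteq> {}"
    "x \<in> verts N \<longleftrightarrow> e \<in> edges N" "y \<in> verts N \<longleftrightarrow> e \<in> edges N"
proof -
  consider (contract) "N \<in> nuclei G" "e \<in> edges N"
    | (avoid) "N \<in> nuclei (delete_edge G e)" "x \<notin> verts N" "y \<notin> verts N"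
    using assms unfolding liftable_nuclei_def by blast
  note cases = this
  show "ends N = ends G" "verts N \<subseteq> verts G" "edges N \<subseteq> edges G" "verts N \<noteq> {}"
    using cases by (cases; auto simp: mem_nuclei_G mem_nuclei_delete)+
  show sub: "\<And>f. f \<in> edges N \<Longrightarrow> ends G f \<subseteq> verts N"
    using cases by (cases; simp add: mem_nuclei_G mem_nuclei_delete)
  show "\<And>S. S \<subseteq> verts N \<Longrightarrow> S \<noteq> {} \<Longrightarrow> edge_closed N S \<Longrightarrow> verts N \<subseteq> S"
    using cases by (cases; simp add: mem_nuclei_G mem_nuclei_delete)
  show "\<And>f. f \<in> edges G \<Longrightarrow> f \<noteq> e \<Longrightarrow> ends G f \<inter> verts N \<noteq> {}"
    using cases by (cases; simp add: mem_nuclei_G mem_nuclei_delete)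
  have "(x \<in> verts N \<longleftrightarrow> e \<in> edges N) \<and> (y \<in> verts N \<longleftrightarrow> e \<in> edges N)"
    using cases by cases (use sub[of e] ends_e in auto)
  then show "x \<in> verts N \<longleftrightarrow> e \<in> edges N" "y \<in> verts N \<longleftrightarrow> e \<in> edges N" by auto
qed

lemma vimage_liftable:
  assumes "N \<in> liftable_nuclei"
  shows "verts G \<inter> \<pi> -` \<pi> ` verts N = verts N"
proof -
  note N = liftable_nucleiD[OF assms]
  have "v \<in> verts N" if "v \<in> verts G" "u \<in> verts N" "\<pi> v = \<pi> u" for u v
    using pi_eq_iff[of v u] that N by blast
  with N(2) show ?thesis by blast
qed

lemma lift_quotient:
  assumes "N \<in> liftable_nuclei"
  shows "lift (quotient_graph \<pi> e N) = N"
proof -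
  note N = liftable_nucleiD[OF assms]
  have "\<pi> x \<in> \<pi> ` verts N \<longleftrightarrow> e \<in> edges N"
    using vimage_liftable[OF assms] xy_in N(8) by blast
  then show ?thesis
    using N(1) vimage_liftable[OF assms] by (intro ugraph.equality) auto
qed

lemma quotient_lift:
  assumes "N' \<in> nuclei Q"
  shows "quotient_graph \<pi> e (lift N') = N'"
proof -
  have V: "verts N' \<subseteq> \<pi> ` verts G" and E: "e \<notin> edges N'" and ends': "ends N' = ends Q"
    using assms unfolding mem_nuclei_Q by auto
  show ?thesis
  proof (rule ugraph.equality)
    show "verts (quotient_graph \<pi> e (lift N')) = verts N'" using V by auto
    show "edges (quotient_graph \<pi> e (lift N')) = edges N'" using E by auto
    show "ends (quotient_graph \<pi> e (lift N')) = ends N'" by (rule ext) (simp add: ends')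
  qed simp
qed

text \<open>A closed set of the contracted nucleus pulls back to a closed set: along \<open>e\<close> nothing can
  leave it, because \<open>\<pi>\<close> does not separate \<open>x\<close> from \<open>y\<close>.\<close>

lemma quotient_in_nuclei:
  assumes "N \<in> liftable_nuclei"
  shows "quotient_graph \<pi> e N \<in> nuclei Q"
proof -
  note N = liftable_nucleiD[OF assms]
  let ?M = "quotient_graph \<pi> e N"
  have conn: "\<pi> ` verts N \<subseteq> S'"
    if S': "S' \<subseteq> \<pi> ` verts N" "S' \<noteq> {}" "edge_closed ?M S'" for S'
  proof -
    define S where "S = {v \<in> verts N. \<pi> v \<in> S'}"
    have "edge_closed N S"
      unfolding edge_closed_def
    proof (intro ballI impI)
      fix f assume f: "f \<in> edges N" and meet: "ends N f \<inter> S \<noteq> {}"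
      show "ends N f \<subseteq> S"
      proof (cases "f = e")
        case True
        then show ?thesis using meet f N(1,8,9) ends_e pi_xy by (auto simp: S_def)
      next
        case False
        then have "\<pi> ` ends N f \<subseteq> S'"
          using S'(3) f meet by (auto simp: edge_closed_def S_def)
        then show ?thesis using N(1) N(4)[OF f] by (auto simp: S_def)
      qed
    qed
    moreover have "S \<subseteq> verts N" "S \<noteq> {}" using S' by (auto simp: S_def)
    ultimately have "verts N \<subseteq> S" using N(6) by blast
    then show ?thesis by (auto simp: S_def)
  qed
  have cover: "\<pi> ` ends G f \<inter> \<pi> ` verts N \<noteq> {}" if "f \<in> edges G" "f \<noteq> e" for f
    using N(7)[OF that] by blast
  have sub: "\<pi> ` ends G f \<subseteq> \<pi> ` verts N" if "f \<in> edges N" for f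
    using N(4)[OF that] by blast
  have "ends ?M = ends Q" using N(1) by (simp add: quotient_graph_def)
  then show ?thesis
    unfolding mem_nuclei_Q using N(2,3,5) sub conn cover by (simp add: image_mono) blast
qed

text \<open>The image of a closed set of the lift is closed, because such a set is a union of fibres
  of \<open>\<pi>\<close> over its image.\<close>

lemma lift_in_liftable:
  assumes N': "N' \<in> nuclei Q"
  shows "lift N' \<in> liftable_nuclei"
proof -
  let ?N = "lift N'"
  have ends': "ends N' = (\<lambda>f. \<pi> ` ends G f)"
    and V': "verts N' \<subseteq> \<pi> ` verts G" and E': "edges N' \<subseteq> edges G - {e}"
    and sub': "\<And>f. f \<in> edges N' \<Longrightarrow> \<pi> ` ends G f \<subseteq> verts N'" and ne': "verts N' \<noteq> {}"
    and conn': "\<And>S. S \<subseteq> verts N' \<Longrightarrow> S \<noteq> {} \<Longrightarrow> edge_closed N' S \<Longrightarrow> verts N' \<subseteq> S"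
    and cover': "\<And>f. f \<in> edges G \<Longrightarrow> f \<noteq> e \<Longrightarrow> \<pi> ` ends G f \<inter> verts N' \<noteq> {}"
    using N' unfolding mem_nuclei_Q by (simp_all add: quotient_graph_def)
  have sub: "ends G f \<subseteq> verts ?N" if f: "f \<in> edges ?N" for f
  proof (cases "f = e")
    case True
    then have "\<pi> x \<in> verts N'" using f E' by (auto split: if_splits)
    then show ?thesis using True ends_e xy_in pi_xy by auto
  next
    case False
    then have "f \<in> edges N'" using f by (auto split: if_splits)
    then show ?thesis
      using sub'[of f] E' ends_subset_verts[OF multigraph, of f] by auto
  qed
  have conn: "verts ?N \<subseteq> S" if S: "S \<subseteq> verts ?N" "S \<noteq> {}" "edge_closed ?N S" for S
  proof -
    \<comment> \<open>The only possible failure of saturation is at \<open>x\<close> and \<open>y\<close>, and there the lifted edge \<open>e\<close>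
      joins the two.\<close>
    have saturated: "u \<in> S" if u: "u \<in> verts G" "w \<in> S" "\<pi> u = \<pi> w" for u w
    proof (cases "u = w")
      case False
      have "w \<in> verts G" "\<pi> w \<in> verts N'" using S(1) u(2) by auto
      then have uw: "u \<in> {x, y}" "w \<in> {x, y}" using pi_eq_iff u False by blast+
      then have "e \<in> edges ?N" using \<open>\<pi> w \<in> verts N'\<close> pi_xy by auto
      then show ?thesis using edge_closedD[OF S(3), of e w u] ends_e uw u(2) by simp
    qed (use u in simp)
    have "edge_closed N' (\<pi> ` S)"
      unfolding edge_closed_def
    proof (intro ballI impI)
      fix f assume f: "f \<in> edges N'" and "ends N' f \<inter> \<pi> ` S \<noteq> {}"
      then obtain u w where uw: "u \<in> ends G f" "w \<in> S" "\<pi> u = \<pi> w"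
        using ends' by auto
      have "u \<in> verts G" using uw f E' ends_subset_verts[OF multigraph, of f] by auto
      then have "u \<in> S" using saturated uw by blast
      moreover have "f \<in> edges ?N" using f by simp
      ultimately have "ends G f \<subseteq> S" using S(3) uw by (auto simp: edge_closed_def)
      then show "ends N' f \<subseteq> \<pi> ` S" using ends' by auto
    qed
    then have "verts N' \<subseteq> \<pi> ` S" using S conn'[of "\<pi> ` S"] by auto
    then show ?thesis using saturated by auto
  qed
  have cover: "ends G f \<inter> verts ?N \<noteq> {}" if f: "f \<in> edges G" "f \<noteq> e" for f
  proof -
    obtain u where "u \<in> ends G f" "\<pi> u \<in> verts N'" using cover'[OF f] by auto
    then show ?thesis using ends_subset_verts[OF multigraph f(1)] by auto
  qed
  have ne: "verts ?N \<noteq> {}" using V' ne' by auto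
  show ?thesis
  proof (cases "\<pi> x \<in> verts N'")
    case True
    have "ends G e \<inter> verts ?N \<noteq> {}" using True ends_e xy_in by auto
    then have "\<forall>f\<in>edges G. ends G f \<inter> verts ?N \<noteq> {}" using cover by blast
    moreover have "edges ?N \<subseteq> edges G" using E' e_in by auto
    ultimately have "?N \<in> nuclei G"
      unfolding mem_nuclei_G using sub conn ne by auto
    then show ?thesis using True by (simp add: liftable_nuclei_def)
  next
    case False
    have "edges ?N \<subseteq> edges G - {e}" using E' False by simp
    then have "?N \<in> nuclei (delete_edge G e)"
      unfolding mem_nuclei_delete using sub conn ne cover by auto
    then show ?thesis using False pi_xy by (simp add: liftable_nuclei_def)
  qed
qed

lemma nuclei_without_e:
  "{N \<in> nuclei G. e \<notin> edges N} =
     {N \<in> nuclei (delete_edge G e). x \<in> verts N \<or> y \<in> verts N}"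
proof (rule Collect_cong)
  fix N :: "('v, 'e) ugraph"
  have "edges N \<subseteq> edges G - {e} \<longleftrightarrow> edges N \<subseteq> edges G \<and> e \<notin> edges N" by blast
  moreover have "(\<forall>f\<in>edges G. ends G f \<inter> verts N \<noteq> {}) \<longleftrightarrow>
      (x \<in> verts N \<or> y \<in> verts N) \<and> (\<forall>f\<in>edges G - {e}. ends G f \<inter> verts N \<noteq> {})"
    using e_in ends_e by (metis Diff_iff Int_insert_left_if0 Int_insert_left_if1 Int_empty_left insert_not_empty singletonD)
  ultimately show "N \<in> nuclei G \<and> e \<notin> edges N \<longleftrightarrow>
      N \<in> nuclei (delete_edge G e) \<and> (x \<in> verts N \<or> y \<in> verts N)"
    unfolding mem_nuclei_G mem_nuclei_delete delete_edge_simps by argo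
qed

text \<open>The nuclei of \<open>G - e\<close> avoiding \<open>x\<close> and \<open>y\<close> occur in both summands on the right and cancel: the
  signs \<open>(-1) ^ card (edges N)\<close> agree, but \<open>G/e\<close> has one vertex less. A nucleus with \<open>e\<close> loses an edge by the
  contraction, and the two changes of sign compensate.\<close>

theorem weighted_els_deletion_contraction:
  "weighted_els g G =
     weighted_els g (delete_edge G e) + weighted_els (\<lambda>W. g (verts G \<inter> \<pi> -` W)) Q"
proof -
  let ?s = "\<lambda>N. (-1) ^ card (edges N) * g (verts N) :: int"
  let ?A = "{N \<in> nuclei G. e \<in> edges N}"
  let ?B = "{N \<in> nuclei (delete_edge G e). x \<notin> verts N \<and> y \<notin> verts N}"
  let ?C = "{N \<in> nuclei G. e \<notin> edges N}"
  note fin = finite_nuclei[OF multigraph]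
    finite_nuclei[OF multigraph_delete_edge[OF multigraph, of e]]
  have e_notin: "e \<notin> edges N" if "N \<in> nuclei (delete_edge G e)" for N
    using that unfolding mem_nuclei_delete by auto
  have "(\<Sum>N'\<in>nuclei Q. (-1) ^ card (edges N') * g (verts G \<inter> \<pi> -` verts N')) =
      (\<Sum>N\<in>liftable_nuclei. (-1) ^ card (edges N - {e}) * g (verts N))"
  proof (rule sum.reindex_bij_witness[where i = "quotient_graph \<pi> e" and j = lift])
    fix N' assume "N' \<in> nuclei Q"
    then have "edges (lift N') - {e} = edges N'" by (auto simp: mem_nuclei_Q)
    then show "(-1) ^ card (edges (lift N') - {e}) * g (verts (lift N')) =
        (-1) ^ card (edges N') * g (verts G \<inter> \<pi> -` verts N')" by simp
  qed (rule quotient_lift lift_in_liftable lift_quotient quotient_in_nuclei; assumption)+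
  also have "\<dots> = (\<Sum>N\<in>?A. (-1) ^ card (edges N - {e}) * g (verts N)) +
      (\<Sum>N\<in>?B. (-1) ^ card (edges N - {e}) * g (verts N))"
    unfolding liftable_nuclei_def using fin e_notin
    by (intro sum.union_disjoint) auto
  also have "(\<Sum>N\<in>?B. (-1) ^ card (edges N - {e}) * g (verts N)) = sum ?s ?B"
  proof (rule sum.cong)
    fix N assume "N \<in> ?B"
    then have "edges N - {e} = edges N" using e_notin by auto
    then show "(-1) ^ card (edges N - {e}) * g (verts N) = ?s N" by simp
  qed simp
  also have "(\<Sum>N\<in>?A. (-1) ^ card (edges N - {e}) * g (verts N)) = - sum ?s ?A"
    unfolding sum_negf[symmetric]
  proof (rule sum.cong)
    fix N assume "N \<in> ?A"
    then have "card (edges N) = Suc (card (edges N - {e}))"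
      using finite_edges_nucleus[of N G] by (simp only: mem_Collect_eq card.remove)
    then show "(-1) ^ card (edges N - {e}) * g (verts N) = - ?s N" by simp
  qed simp
  finally have Q_sum: "(\<Sum>N'\<in>nuclei Q. (-1) ^ card (edges N') * g (verts G \<inter> \<pi> -` verts N')) =
      - sum ?s ?A + sum ?s ?B" .
  have "nuclei G = ?A \<union> ?C" by auto
  then have "sum ?s (nuclei G) = sum ?s ?A + sum ?s ?C"
    using fin by (subst sum.union_disjoint[symmetric]) auto
  moreover have "nuclei (delete_edge G e) = ?B \<union> ?C" unfolding nuclei_without_e by auto
  then have "sum ?s (nuclei (delete_edge G e)) = sum ?s ?B + sum ?s ?C"
    using fin unfolding nuclei_without_e by (subst sum.union_disjoint[symmetric]) auto
  ultimately have "sum ?s (nuclei G) = sum ?s (nuclei (delete_edge G e)) -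
      (\<Sum>N'\<in>nuclei Q. (-1) ^ card (edges N') * g (verts G \<inter> \<pi> -` verts N'))"
    using Q_sum by simp
  then show ?thesis
    unfolding weighted_els_def delete_edge_simps(1) card_verts_quotient
    by (simp add: right_diff_distrib)
qed

lemma graph_connected_quotient:
  assumes "graph_connected G"
  shows "graph_connected Q"
proof -
  \<comment> \<open>A connected graph is a nucleus of itself, and contraction maps nuclei with \<open>e\<close> to nuclei.\<close>
  have "G \<in> nuclei G"
    using assms multigraph ends_subset_verts[OF multigraph] ends_nonempty[OF multigraph]
    by (fastforce simp: nuclei_def subgraph_of_def vertex_cover_def)
  then have "Q \<in> nuclei Q"
    using quotient_in_nuclei[of G] e_in by (simp add: liftable_nuclei_def)
  then show ?thesis by (simp add: nuclei_def)
qed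

lemma through_vimage_iff:
  assumes "U \<subseteq> verts G"
  shows "U \<subseteq> verts G \<inter> \<pi> -` W \<longleftrightarrow> \<pi> ` U \<subseteq> W"
  using assms by auto

end


section \<open>Nuclei through prescribed vertices\<close>

definition els_through :: "'v set \<Rightarrow> ('v, 'e) ugraph \<Rightarrow> int" where
  "els_through U = weighted_els (\<lambda>W. of_bool (U \<subseteq> W))"

lemma els_through_altdef:
  assumes "multigraph G"
  shows "els_through U G = (-1) ^ (card (verts G) + 1) *
    (\<Sum>N | N \<in> nuclei G \<and> U \<subseteq> verts N. (-1) ^ card (edges N))"
proof -
  have "(\<Sum>N\<in>nuclei G. (-1) ^ card (edges N) * of_bool (U \<subseteq> verts N)) =
      (\<Sum>N\<in>nuclei G. if U \<subseteq> verts N then (-1) ^ card (edges N) else 0 :: int)"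
    by (rule sum.cong) auto
  also have "\<dots> = (\<Sum>N | N \<in> nuclei G \<and> U \<subseteq> verts N. (-1) ^ card (edges N))"
    by (rule sum.inter_filter[OF finite_nuclei[OF assms], symmetric])
  finally have "(\<Sum>N\<in>nuclei G. (-1) ^ card (edges N) * of_bool (U \<subseteq> verts N)) =
      (\<Sum>N | N \<in> nuclei G \<and> U \<subseteq> verts N. (-1) ^ card (edges N) :: int)" .
  then show ?thesis by (simp add: els_through_def weighted_els_def)
qed

lemma (in contraction_map) els_through_deletion_contraction:
  assumes "U \<subseteq> verts G"
  shows "els_through U G = els_through U (delete_edge G e) + els_through (\<pi> ` U) Q"
  unfolding els_through_def weighted_els_deletion_contraction through_vimage_iff[OF assms] ..

lemma sum_zero_by_involution:
  fixes f :: "'a \<Rightarrow> int"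
  assumes "\<And>a. a \<in> A \<Longrightarrow> \<phi> a \<in> A" "\<And>a. a \<in> A \<Longrightarrow> \<phi> (\<phi> a) = a"
    and "\<And>a. a \<in> A \<Longrightarrow> f (\<phi> a) = - f a"
  shows "sum f A = 0"
proof -
  have "sum f A = (\<Sum>a\<in>A. - f a)"
    by (rule sum.reindex_bij_witness[where i = \<phi> and j = \<phi>]) (use assms in auto)
  then show ?thesis by (simp add: sum_negf)
qed

lemma neg_one_power_card_remove:
  "finite A \<Longrightarrow> a \<in> A \<Longrightarrow> (-1) ^ card (A - {a}) = - ((-1) ^ card A :: int)"
  by (simp only: card.remove power_Suc)

text \<open>Every nucleus contains the vertex of the loop, as it covers the loop. Adding or removing the
  loop is then a sign-reversing involution.\<close>

lemma els_through_eq_0_if_loop: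
  assumes G: "multigraph G" and f: "f \<in> edges G" "is_loop G f"
  shows "els_through U G = 0"
proof -
  obtain v where v: "ends G f = {v}" using f by (auto simp: is_loop_def)
  let ?A = "{N \<in> nuclei G. U \<subseteq> verts N}"
  define \<phi> where "\<phi> N = N\<lparr>edges := if f \<in> edges N then edges N - {f} else insert f (edges N)\<rparr>"
    for N :: "('a, 'b) ugraph"
  have "(\<Sum>N\<in>?A. (-1) ^ card (edges N) :: int) = 0"
  proof (rule sum_zero_by_involution[where \<phi> = \<phi>])
    fix N assume N: "N \<in> ?A"
    then have v_in: "v \<in> verts N" and ends_N: "ends N = ends G"
      using v f(1) by (auto simp: mem_nuclei_iff[OF G])
    have "edge_closed (\<phi> N) S \<longleftrightarrow> edge_closed N S" for S
      using v ends_N by (auto simp: edge_closed_def \<phi>_def)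
    then show "\<phi> N \<in> ?A"
      using N v_in v f(1) unfolding mem_nuclei_iff[OF G] mem_Collect_eq
      by (auto simp: \<phi>_def)
    show "\<phi> (\<phi> N) = N"
      by (cases N) (auto simp: \<phi>_def)
    show "(-1) ^ card (edges (\<phi> N)) = - ((-1) ^ card (edges N) :: int)"
      using N finite_edges_nucleus[of N G]
      by (auto simp: \<phi>_def neg_one_power_card_remove simp del: card_Diff_insert)
  qed
  then show ?thesis by (simp add: els_through_altdef[OF G])
qed

text \<open>Adding or removing the pendant vertex \<open>y\<close> together with its edge \<open>e\<close> is a sign-reversing
  involution. A nucleus contains \<open>x\<close>: otherwise it would cover \<open>e\<close> by \<open>y\<close> alone and, being
  connected, consist of \<open>y\<close> only, contrary to \<open>U\<close> being nonempty without \<open>y\<close>.\<close>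

lemma els_through_eq_0_if_pendant:
  assumes G: "multigraph G" and e: "e \<in> edges G" "ends G e = {x, y}" "x \<noteq> y"
    and pendant: "\<And>f. f \<in> edges G \<Longrightarrow> y \<in> ends G f \<Longrightarrow> f = e"
    and U: "y \<notin> U" "U \<noteq> {}"
  shows "els_through U G = 0"
proof -
  let ?A = "{N \<in> nuclei G. U \<subseteq> verts N}"
  have xy: "x \<in> verts G" "y \<in> verts G" using ends_subset_verts[OF G e(1)] e by auto
  define \<phi> where "\<phi> N =
      (if e \<in> edges N then N\<lparr>verts := verts N - {y}, edges := edges N - {e}\<rparr>
       else N\<lparr>verts := insert y (verts N), edges := insert e (edges N)\<rparr>)"
    for N :: "('a, 'b) ugraph"
  have "(\<Sum>N\<in>?A. (-1) ^ card (edges N) :: int) = 0"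
  proof (rule sum_zero_by_involution[where \<phi> = \<phi>])
    fix N assume "N \<in> ?A"
    then have N: "N \<in> nuclei G" and UN: "U \<subseteq> verts N" by auto
    have ends_N: "ends N = ends G" and V: "verts N \<subseteq> verts G" and E: "edges N \<subseteq> edges G"
      and sub: "\<And>f. f \<in> edges N \<Longrightarrow> ends G f \<subseteq> verts N"
      and conn: "\<And>S. S \<subseteq> verts N \<Longrightarrow> S \<noteq> {} \<Longrightarrow> edge_closed N S \<Longrightarrow> verts N \<subseteq> S"
      and cover: "\<And>f. f \<in> edges G \<Longrightarrow> ends G f \<inter> verts N \<noteq> {}"
      using N by (auto simp: mem_nuclei_iff[OF G])
    \<comment> \<open>A vertex of \<open>U\<close> keeps the nucleus from being the single vertex \<open>y\<close>.\<close>
    obtain u where u: "u \<in> verts N" "u \<noteq> y" using U UN by auto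
    have y_iff: "y \<in> verts N \<longleftrightarrow> e \<in> edges N"
    proof
      assume y: "y \<in> verts N"
      show "e \<in> edges N"
      proof (rule ccontr)
        assume "e \<notin> edges N"
        then have "edge_closed N {y}"
          using pendant E ends_N by (auto simp: edge_closed_def)
        then show False using conn[of "{y}"] y u by auto
      qed
    qed (use sub e in auto)
    have x_in: "x \<in> verts N" using y_iff cover[OF e(1)] sub[of e] e by auto
    show "\<phi> N \<in> ?A"
    proof (cases "e \<in> edges N")
      case True
      have conn_del: "verts N - {y} \<subseteq> S"
        if S: "S \<subseteq> verts N - {y}" "S \<noteq> {}" "edge_closed (\<phi> N) S" for S
      proof -
        \<comment> \<open>Without \<open>e\<close> the vertex \<open>x\<close> no longer forces \<open>y\<close>, so \<open>y\<close> has to be put back.\<close>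
        define T where "T = (if x \<in> S then insert y S else S)"
        have "edge_closed N T"
          unfolding edge_closed_def
        proof (intro ballI impI)
          fix f assume f: "f \<in> edges N" and meet: "ends N f \<inter> T \<noteq> {}"
          show "ends N f \<subseteq> T"
          proof (cases "f = e")
            case True
            then show ?thesis using meet ends_N e S(1) by (auto simp: T_def split: if_splits)
          next
            case False
            then have "f \<in> edges (\<phi> N)" "y \<notin> ends N f"
              using f \<open>e \<in> edges N\<close> pendant E ends_N by (auto simp: \<phi>_def)
            moreover have "ends (\<phi> N) = ends N" by (simp add: \<phi>_def)
            ultimately show ?thesis
              using meet S(3) unfolding edge_closed_def T_def by (auto split: if_splits)
          qed
        qed
        moreover have "T \<subseteq> verts N" "T \<noteq> {}" using S True y_iff by (auto simp: T_def)
        ultimately have "verts N \<subseteq> T" using conn by blast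
        then show ?thesis by (auto simp: T_def split: if_splits)
      qed
      have sub_del: "ends G f \<subseteq> verts N - {y}" if "f \<in> edges N - {e}" for f
        using that sub[of f] pendant[of f] E by auto
      have cover_del: "ends G f \<inter> (verts N - {y}) \<noteq> {}" if f: "f \<in> edges G" for f
      proof (cases "f = e")
        case True
        then show ?thesis using e x_in by auto
      next
        case False
        then show ?thesis using cover[OF f] pendant[OF f] by auto
      qed
      have \<phi>_simps: "verts (\<phi> N) = verts N - {y}" "edges (\<phi> N) = edges N - {e}"
        "ends (\<phi> N) = ends G"
        using True ends_N by (simp_all add: \<phi>_def)
      have ok: "verts N - {y} \<subseteq> verts G" "edges N - {e} \<subseteq> edges G" "verts N - {y} \<noteq> {}"
        using V E x_in e(3) by auto
      have "\<phi> N \<in> nuclei G"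
        unfolding mem_nuclei_iff[OF G] \<phi>_simps
        by (intro conjI ballI allI impI refl ok; rule sub_del cover_del conn_del; assumption)
      moreover have "U \<subseteq> verts (\<phi> N)" using \<phi>_simps U(1) UN by auto
      ultimately show ?thesis by simp
    next
      case False
      have conn_ins: "insert y (verts N) \<subseteq> S"
        if S: "S \<subseteq> insert y (verts N)" "S \<noteq> {}" "edge_closed (\<phi> N) S" for S
      proof -
        have "e \<in> edges (\<phi> N)" "ends (\<phi> N) e = {x, y}"
          using False e ends_N by (auto simp: \<phi>_def)
        then have xy_S: "x \<in> S \<longleftrightarrow> y \<in> S" using S(3) by (auto simp: edge_closed_def)
        have "edge_closed N (S - {y})"
          unfolding edge_closed_def
        proof (intro ballI impI)
          fix f assume f: "f \<in> edges N" and meet: "ends N f \<inter> (S - {y}) \<noteq> {}"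
          have "f \<in> edges (\<phi> N)" "ends (\<phi> N) f = ends N f" "y \<notin> ends N f"
            using f False pendant E ends_N by (auto simp: \<phi>_def)
          then show "ends N f \<subseteq> S - {y}"
            using meet S(3) unfolding edge_closed_def by auto
        qed
        moreover have "S - {y} \<noteq> {}" using S(2) xy_S e(3) by blast
        moreover have "S - {y} \<subseteq> verts N" using S(1) by blast
        ultimately have "verts N \<subseteq> S - {y}" using conn by blast
        then show ?thesis using x_in xy_S by auto
      qed
      have sub_ins: "ends G f \<subseteq> insert y (verts N)" if "f \<in> insert e (edges N)" for f
        using that sub[of f] e(2) x_in by auto
      have cover_ins: "ends G f \<inter> insert y (verts N) \<noteq> {}" if "f \<in> edges G" for f
        using cover[OF that] by blast
      have \<phi>_simps: "verts (\<phi> N) = insert y (verts N)" "edges (\<phi> N) = insert e (edges N)"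
        "ends (\<phi> N) = ends G"
        using False ends_N by (simp_all add: \<phi>_def)
      have ok: "insert y (verts N) \<subseteq> verts G" "insert e (edges N) \<subseteq> edges G"
        "insert y (verts N) \<noteq> {}"
        using V E xy e(1) by auto
      have "\<phi> N \<in> nuclei G"
        unfolding mem_nuclei_iff[OF G] \<phi>_simps
        by (intro conjI ballI allI impI refl ok; rule sub_ins cover_ins conn_ins; assumption)
      moreover have "U \<subseteq> verts (\<phi> N)" using \<phi>_simps UN by auto
      ultimately show ?thesis by simp
    qed
    show "\<phi> (\<phi> N) = N"
      using y_iff by (cases N) (auto simp: \<phi>_def)
    show "(-1) ^ card (edges (\<phi> N)) = - ((-1) ^ card (edges N) :: int)"
      using N finite_edges_nucleus[of N G]
      by (auto simp: \<phi>_def neg_one_power_card_remove simp del: card_Diff_insert)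
  qed
  then show ?thesis by (simp add: els_through_altdef[OF G])
qed

text \<open>A vertex outside a nucleus that lies on some edge is adjacent to the nucleus, since the
  nucleus covers that edge.\<close>

lemma graph_connected_if_dominating_nucleus:
  assumes G: "multigraph G" and N: "N \<in> nuclei G"
    and dom: "\<And>v. v \<in> verts G \<Longrightarrow> v \<notin> verts N \<Longrightarrow> \<exists>f\<in>edges G. v \<in> ends G f"
  shows "graph_connected G"
  unfolding graph_connected_iff_no_proper_closed_set[OF G]
proof (intro conjI allI impI)
  have ends_N: "ends N = ends G" and V: "verts N \<subseteq> verts G" and E: "edges N \<subseteq> edges G"
    and ne: "verts N \<noteq> {}"
    and conn: "\<And>S. S \<subseteq> verts N \<Longrightarrow> S \<noteq> {} \<Longrightarrow> edge_closed N S \<Longrightarrow> verts N \<subseteq> S"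
    and sub: "\<And>f. f \<in> edges N \<Longrightarrow> ends G f \<subseteq> verts N"
    and cover: "\<And>f. f \<in> edges G \<Longrightarrow> ends G f \<inter> verts N \<noteq> {}"
    using N by (auto simp: mem_nuclei_iff[OF G])
  show "verts G \<noteq> {}" using V ne by auto
  fix S assume S: "S \<subseteq> verts G" "S \<noteq> {}" "edge_closed G S"
  have nbr: "\<exists>w\<in>verts N. w \<in> S \<longleftrightarrow> v \<in> S" if v: "v \<in> verts G" for v
  proof (cases "v \<in> verts N")
    case False
    then obtain f w where "f \<in> edges G" "v \<in> ends G f" "w \<in> ends G f" "w \<in> verts N"
      using dom[OF v] cover by blast
    then show ?thesis using edge_closedD[OF S(3)] by blast
  qed auto
  have "edge_closed N (S \<inter> verts N)"
    unfolding edge_closed_def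
  proof (intro ballI impI)
    fix f assume "f \<in> edges N" "ends N f \<inter> (S \<inter> verts N) \<noteq> {}"
    then show "ends N f \<subseteq> S \<inter> verts N"
      using edge_closedD[OF S(3), of f] E ends_N sub by auto
  qed
  moreover have "S \<inter> verts N \<noteq> {}" using S(1,2) nbr by blast
  ultimately have "verts N \<subseteq> S" using conn[of "S \<inter> verts N"] by auto
  then show "verts G \<subseteq> S" using nbr by blast
qed

lemma connected_incident_edge:
  assumes G: "multigraph G" "graph_connected G" and v: "v \<in> verts G" and u: "u \<in> verts G" "u \<noteq> v"
  shows "\<exists>f\<in>edges G. v \<in> ends G f"
proof (rule ccontr)
  assume "\<not> ?thesis"
  then have "edge_closed G {v}" by (auto simp: edge_closed_def)
  then show False
    using G u v graph_connected_iff_no_proper_closed_set[OF G(1)] by blast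
qed

text \<open>The inductive step is for graphs with an edge but without loops and without pendant vertices
  outside \<open>U\<close>. Both \<open>G/e\<close> and \<open>G - e\<close> have fewer edges, and \<open>G/e\<close> is connected. If
  \<open>G - e\<close> has a nucleus through \<open>U\<close>, then it is connected as well: a vertex off the nucleus is not
  in \<open>U\<close>, so it is not pendant in \<open>G\<close> and retains an edge after the deletion of \<open>e\<close>.\<close>

theorem els_through_nonneg:
  fixes G :: "('v, 'e) ugraph"
  assumes "multigraph G" "graph_connected G" "U \<noteq> {}"
  shows "0 \<le> els_through U G"
  using assms
proof (induction "card (edges G)" arbitrary: G U rule: less_induct)
  case less
  note G = less.prems(1) and conn = less.prems(2) and U = less.prems(3)
  have fin: "finite (edges G)" using G by (simp add: multigraph_def)
  consider (not_sub) "\<not> U \<subseteq> verts G"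
    | (edgeless) "edges G = {}"
    | (loop) f where "f \<in> edges G" "is_loop G f"
    | (pendant) e y where "e \<in> edges G" "y \<in> ends G e" "y \<notin> U" "\<not> is_loop G e"
        "\<And>f. f \<in> edges G \<Longrightarrow> y \<in> ends G f \<Longrightarrow> f = e"
    | (reducible) e where "e \<in> edges G" "\<not> is_loop G e" "U \<subseteq> verts G"
        "\<And>y f. y \<notin> U \<Longrightarrow> f \<in> edges G \<Longrightarrow> y \<in> ends G f \<Longrightarrow> \<exists>f'\<in>edges G. f' \<noteq> f \<and> y \<in> ends G f'"
    by (metis all_not_in_conv)
  then show ?case
  proof cases
    case not_sub
    then have "{N. N \<in> nuclei G \<and> U \<subseteq> verts N} = {}"
      using verts_nucleus_subset by blast
    then show ?thesis by (simp only: els_through_altdef[OF G]) simp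
  next
    case edgeless
    obtain v where v: "v \<in> verts G" using conn by (auto simp: graph_connected_def)
    then have "verts G = {v}"
      using connected_incident_edge[OF G conn v] edgeless by blast
    moreover have "edges N = {}" if "N \<in> nuclei G" for N
      using that edgeless by (simp add: mem_nuclei_iff[OF G])
    ultimately show ?thesis
      by (auto simp: els_through_altdef[OF G] intro!: sum_nonneg)
  next
    case loop
    then show ?thesis using els_through_eq_0_if_loop[OF G] by simp
  next
    case pendant
    obtain a b where ab: "ends G e = {a, b}" "a \<noteq> b"
      using G pendant(1,4) unfolding multigraph_def is_loop_def by (metis insert_absorb2)
    then obtain x where "ends G e = {x, y}" "x \<noteq> y"
      using pendant(2) by (metis insertE insert_commute singletonD)
    then show ?thesis
      using els_through_eq_0_if_pendant[OF G pendant(1) _ _ pendant(5) pendant(3) U] by simp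
  next
    case reducible
    obtain x y where xy: "ends G e = {x, y}" "x \<noteq> y"
      using G reducible(1,2) unfolding multigraph_def is_loop_def by (metis insert_absorb2)
    \<comment> \<open>Contract \<open>e\<close> without leaving the vertex type, so that the induction hypothesis applies.\<close>
    define \<pi> where "\<pi> v = (if v = y then x else v)" for v
    interpret contraction_map G e x y \<pi>
      by unfold_locales (use G reducible(1) xy in \<open>auto simp: \<pi>_def\<close>)
    have smaller: "card (edges G - {e}) < card (edges G)"
      using fin reducible(1) by (rule card_Diff1_less)
    have "0 \<le> els_through (\<pi> ` U) Q"
      using less.hyps[of Q "\<pi> ` U"] smaller multigraph_quotient_graph[OF G, of \<pi> e]
        graph_connected_quotient[OF conn] U by simp
    moreover have "0 \<le> els_through U (delete_edge G e)"
    proof (cases "\<exists>N\<in>nuclei (delete_edge G e). U \<subseteq> verts N")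
      case True
      then obtain N where N: "N \<in> nuclei (delete_edge G e)" "U \<subseteq> verts N" by blast
      obtain u where u: "u \<in> U" using U by blast
      have "\<exists>f\<in>edges G - {e}. v \<in> ends G f" if v: "v \<in> verts G" "v \<notin> verts N" for v
      proof -
        have "v \<noteq> u" "v \<notin> U" "u \<in> verts G" using u N(2) v reducible(3) by auto
        then obtain f where f: "f \<in> edges G" "v \<in> ends G f"
          using connected_incident_edge[OF G conn v(1)] by blast
        then show ?thesis using reducible(4)[OF \<open>v \<notin> U\<close>] by (metis DiffI singletonD)
      qed
      then have "graph_connected (delete_edge G e)"
        using graph_connected_if_dominating_nucleus[OF multigraph_delete_edge[OF G] N(1)] by simp
      then show ?thesis
        using less.hyps[of "delete_edge G e" U] smaller multigraph_delete_edge[OF G] U by simp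
    next
      case False
      then have "{N. N \<in> nuclei (delete_edge G e) \<and> U \<subseteq> verts N} = {}" by blast
      then show ?thesis
        by (simp only: els_through_altdef[OF multigraph_delete_edge[OF G]]) simp
    qed
    ultimately show ?thesis
      using els_through_deletion_contraction[OF reducible(3)] by simp
  qed
qed


section \<open>Powers of the number of vertices\<close>

definition words_with :: "'v \<Rightarrow> 'v set \<Rightarrow> nat \<Rightarrow> 'v list set" where
  "words_with y W k = {xs. set xs \<subseteq> W \<and> length xs = k \<and> y \<in> set xs}"

lemma finite_words_with: "finite W \<Longrightarrow> finite (words_with y W k)"
  unfolding words_with_def by (rule finite_subset[OF _ finite_lists_length_eq[of W k]]) auto

text \<open>Counting all words, the words without \<open>y\<close>, and the words with \<open>y\<close>.\<close>

lemma card_power_eq_card_words_with: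
  assumes "finite W"
  shows "card W ^ k = card (W - {y}) ^ k + card (words_with y W k)"
proof -
  have fin: "finite {xs. set xs \<subseteq> W - {y} \<and> length xs = k}"
    by (rule finite_lists_length_eq) (use assms in simp)
  have "{xs. set xs \<subseteq> W \<and> length xs = k} =
      {xs. set xs \<subseteq> W - {y} \<and> length xs = k} \<union> words_with y W k"
    by (auto simp: words_with_def)
  moreover have "{xs. set xs \<subseteq> W - {y} \<and> length xs = k} \<inter> words_with y W k = {}"
    by (auto simp: words_with_def)
  ultimately have "card {xs. set xs \<subseteq> W \<and> length xs = k} =
      card {xs. set xs \<subseteq> W - {y} \<and> length xs = k} + card (words_with y W k)"
    by (simp only: card_Un_disjoint[OF fin finite_words_with[OF assms]])
  then show ?thesis
    by (simp only: card_lists_length_eq assms finite_Diff)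
qed

context contraction_map
begin

text \<open>The power of \<open>|W|\<close> accounts for the words avoiding \<open>y\<close>, since \<open>\<pi>\<close> identifies the preimage of
  \<open>W\<close> without \<open>y\<close> with \<open>W\<close>. A word with \<open>y\<close> has its letters in the preimage iff \<open>W\<close> contains their
  images, so the excess is a combination of indicators of \<open>U \<subseteq> W\<close> with coefficients that do not
  depend on \<open>W\<close>.\<close>

lemma card_vimage_power:
  assumes W: "W \<subseteq> verts Q"
  shows "int (card (verts G \<inter> \<pi> -` W)) ^ k = int (card W) ^ k +
    (\<Sum>xs\<in>words_with y (verts G) k. of_bool (\<pi> ` set xs \<subseteq> W))"
proof -
  let ?W = "verts G \<inter> \<pi> -` W"
  have fin: "finite (verts G)" using multigraph by (simp add: multigraph_def)
  have "card (?W - {y}) = card W" by (rule card_vimage_minus_y[OF W])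
  moreover have "words_with y ?W k = {xs \<in> words_with y (verts G) k. \<pi> ` set xs \<subseteq> W}"
    by (auto simp: words_with_def)
  ultimately have "card ?W ^ k = card W ^ k +
      card {xs \<in> words_with y (verts G) k. \<pi> ` set xs \<subseteq> W}"
    using card_power_eq_card_words_with[of ?W k y] fin by simp
  then have "int (card ?W) ^ k = int (card W) ^ k +
      int (card {xs \<in> words_with y (verts G) k. \<pi> ` set xs \<subseteq> W})"
    by (metis of_nat_add of_nat_power)
  then show ?thesis
    using finite_words_with[OF fin, of y k] by (simp add: Int_def)
qed

theorem els_deletion_contraction:
  "els k G = els k Q + els k (delete_edge G e) +
     (\<Sum>xs\<in>words_with y (verts G) k. els_through (\<pi> ` set xs) Q)"
proof -
  have "weighted_els (\<lambda>W. int (card (verts G \<inter> \<pi> -` W)) ^ k) Q =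
      weighted_els (\<lambda>W. int (card W) ^ k +
        (\<Sum>xs\<in>words_with y (verts G) k. of_bool (\<pi> ` set xs \<subseteq> W))) Q"
    by (rule weighted_els_cong) (rule card_vimage_power)
  then show ?thesis
    by (simp add: els_eq_weighted_els weighted_els_deletion_contraction[of "\<lambda>W. int (card W) ^ k"]
        weighted_els_add weighted_els_sum els_through_def)
qed

end


section \<open>The deletion-contraction inequality for Elser numbers\<close>

theorem theorem8p1:
  fixes G :: "('v, 'e) ugraph" and e :: 'e
  assumes "multigraph G"
    and "graph_connected G"
    and "e \<in> edges G"
    and "\<not> is_loop G e"
    and "\<not> is_cut_edge G e"
  shows "(\<forall>k::nat. els k G \<ge> els k (contract_edge G e) + els k (delete_edge G e)) \<and>
         els 0 G = els 0 (contract_edge G e) + els 0 (delete_edge G e)"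
proof -
  obtain x y where xy: "ends G e = {x, y}" "x \<noteq> y"
    using assms(1,3,4) unfolding multigraph_def is_loop_def by (metis insert_absorb2)
  interpret contraction_map G e x y "contract_vertex G e"
    by unfold_locales (use assms xy in \<open>auto simp: contract_vertex_def\<close>)
  have Q_eq: "Q = contract_edge G e"
    by (simp add: quotient_graph_def contract_edge_def)
  have "0 \<le> els_through (contract_vertex G e ` set xs) Q" if "xs \<in> words_with y (verts G) k" for xs k
  proof (rule els_through_nonneg)
    show "multigraph Q" using assms(1) by (rule multigraph_quotient_graph)
    show "graph_connected Q" using assms(2) by (rule graph_connected_quotient)
    show "contract_vertex G e ` set xs \<noteq> {}" using that by (auto simp: words_with_def)
  qed
  then have "0 \<le> (\<Sum>xs\<in>words_with y (verts G) k.
      els_through (contract_vertex G e ` set xs) Q)" for k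
    by (rule sum_nonneg)
  moreover have "words_with y (verts G) 0 = {}" by (auto simp: words_with_def)
  ultimately show ?thesis
    using els_deletion_contraction unfolding Q_eq by simp
qed

end
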